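(* Let $\mathcal{A}=\{1,\dots,A\}$ be a finite set of people, $\mathcal{Y}=\{1,\dots,Y\}$ a finite set of options, $\overline{\mathcal{Y}}=\mathcal{Y}\cup\{o\}$, with rates $\lambda_a>0$, strict preference orders $\succ_a$ on $\mathcal{Y}$ and attention probabilities $\operatorname{Q}_a(v\mid\mathbf{y})$ for $a\in\mathcal{A}$, $v\in\mathcal{Y}$, $\mathbf{y}\in\overline{\mathcal{Y}}^A$. Suppose that $0<\operatorname{Q}_a(v\mid\mathbf{y})<1$ for every $a\in\mathcal{A}$, $v\in\mathcal{Y}$ and $\mathbf{y}\in\overline{\mathcal{Y}}^{A}$. Then there exists a unique equilibrium, i.e. a unique probability distribution $\mu:\overline{\mathcal{Y}}^{A}\to[0,1]$, $\sum_{\mathbf{y}}\mu(\mathbf{y})=1$, with $\mu\mathcal{M}=\mathbf{0}$, where $\mathcal{M}$ is the transition rate matrix of the model.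
   Context: Each Person $a\in\mathcal{A}$ has a strict preference (linear) order $\succ_a$ on $\mathcal{Y}$; $o\notin\mathcal{Y}$ is a default option. People revise their choices at the events of independent Poisson clocks with rates $\lambda_a>0$. A choice configuration is $\mathbf{y}=(y_a)_{a\in\mathcal{A}}\in\overline{\mathcal{Y}}^A$. When revising at configuration $\mathbf{y}$, Person $a$ considers each $v\in\mathcal{Y}$ independently with probability $\operatorname{Q}_a(v\mid\mathbf{y})$ and picks the $\succ_a$-best considered option, or $o$ if none is considered. Hence the conditional choice probabilities are $$\operatorname{P}_a(v\mid\mathbf{y})=\operatorname{Q}_a(v\mid\mathbf{y})\prod_{v'\in\mathcal{Y},\,v'\succ_a v}\bigl(1-\operatorname{Q}_a(v'\mid\mathbf{y})\bigr)\ (v\in\mathcal{Y}),\qquad \operatorname{P}_a(o\mid\mathbf{y})=\prod_{v\in\mathcal{Y}}\bigl(1-\operatorname{Q}_a(v\mid\mathbf{y})\bigr).$$ The transition rate matrix $\mathcal{M}$ is indexed by $\overline{\mathcal{Y}}^A\times\overline{\mathcal{Y}}^A$ and its $(\mathbf{y},\mathbf{y}')$ entry is $\operatorname{m}(\mathbf{y}'\mid\mathbf{y})$, where for $\mathbf{y}'\ne\mathbf{y}$: $\operatorname{m}(\mathbf{y}'\mid\mathbf{y})=0$ if $\mathbf{y},\mathbf{y}'$ differ in more than one component, and $\operatorname{m}(\mathbf{y}'\mid\mathbf{y})=\lambda_a\operatorname{P}_a(y'_a\mid\mathbf{y})$ if they differ exactly in component $a$; and $\operatorname{m}(\mathbf{y}\mid\mathbf{y})=-\sum_{\mathbf{y}'\neq\mathbf{y}}\operatorname{m}(\mathbf{y}'\mid\mathbf{y})$.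 $\mu$ is treated as a row vector. *)

theory Defs
  imports "HOL-Analysis.Analysis"
begin

text \<open>
  People form a finite type \<open>'p\<close> and options a finite type \<open>'v\<close>; the set of options extended
  by the default option is \<open>'v option\<close>, with \<open>None\<close> as the default.  The pair
  \<open>(v', v) \<in> pref a\<close> says that Person \<open>a\<close> strictly prefers \<open>v'\<close> to \<open>v\<close>, and
  \<open>Q a v y\<close> is the probability that Person \<open>a\<close> considers \<open>v\<close> at configuration \<open>y\<close>.
\<close>

type_synonym ('p, 'v) config = "'p \<Rightarrow> 'v option"

definition choice_prob ::
  "('p \<Rightarrow> 'v::finite rel) \<Rightarrow> ('p \<Rightarrow> 'v \<Rightarrow> ('p, 'v) config \<Rightarrow> real) \<Rightarrow>
   'p \<Rightarrow> 'v option \<Rightarrow> ('p, 'v) config \<Rightarrow> real" where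
  "choice_prob pref Q a w y =
     (case w of
        Some v \<Rightarrow> Q a v y * (\<Prod>v' | (v', v) \<in> pref a. 1 - Q a v' y)
      | None \<Rightarrow> (\<Prod>v\<in>UNIV. 1 - Q a v y))"

text \<open>
  The rate of jumping from \<open>y\<close> to \<open>y'\<close>, meaningful for \<open>y' \<noteq> y\<close>.  Argument order follows the
  notation \<open>m(y' | y)\<close>: target first, current configuration second.
\<close>

definition jump_rate ::
  "('p \<Rightarrow> real) \<Rightarrow> ('p \<Rightarrow> 'v::finite rel) \<Rightarrow> ('p \<Rightarrow> 'v \<Rightarrow> ('p, 'v) config \<Rightarrow> real) \<Rightarrow>
   ('p, 'v) config \<Rightarrow> ('p, 'v) config \<Rightarrow> real" where
  "jump_rate lam pref Q y' y =
     (if \<exists>!a. y' a \<noteq> y a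
      then (let a = (THE a. y' a \<noteq> y a) in lam a * choice_prob pref Q a (y' a) y)
      else 0)"

definition transition_rate ::
  "('p::finite \<Rightarrow> real) \<Rightarrow> ('p \<Rightarrow> 'v::finite rel) \<Rightarrow> ('p \<Rightarrow> 'v \<Rightarrow> ('p, 'v) config \<Rightarrow> real) \<Rightarrow>
   ('p, 'v) config \<Rightarrow> ('p, 'v) config \<Rightarrow> real" where
  "transition_rate lam pref Q y' y =
     (if y' = y then - (\<Sum>z\<in>UNIV - {y}. jump_rate lam pref Q z y)
      else jump_rate lam pref Q y' y)"

text \<open>Row index: current configuration; column index: next configuration.\<close>

definition transition_matrix ::
  "('p::finite \<Rightarrow> real) \<Rightarrow> ('p \<Rightarrow> 'v::finite rel) \<Rightarrow> ('p \<Rightarrow> 'v \<Rightarrow> ('p, 'v) config \<Rightarrow> real) \<Rightarrow>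
   real ^ ('p, 'v) config ^ ('p, 'v) config" where
  "transition_matrix lam pref Q = (\<chi> y y'. transition_rate lam pref Q y' y)"

definition equilibrium ::
  "('p::finite \<Rightarrow> real) \<Rightarrow> ('p \<Rightarrow> 'v::finite rel) \<Rightarrow> ('p \<Rightarrow> 'v \<Rightarrow> ('p, 'v) config \<Rightarrow> real) \<Rightarrow>
   real ^ ('p, 'v) config \<Rightarrow> bool" where
  "equilibrium lam pref Q \<mu> \<longleftrightarrow>
     (\<forall>y. 0 \<le> \<mu> $ y \<and> \<mu> $ y \<le> 1) \<and>
     (\<Sum>y\<in>UNIV. \<mu> $ y) = 1 \<and>
     \<mu> v* transition_matrix lam pref Q = 0"

end

theory Submission
  imports Defs
begin

text \<open>
  For an irreducible generator, a left null vector \<open>\<mu>\<close> exists because the rows sum to zero.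
  The triangle inequality gives \<open>\<bar>\<mu>\<bar> M \<ge> 0\<close> componentwise; these components sum to zero, so
  \<open>\<bar>\<mu>\<bar>\<close> is again a left null vector, and normalising it gives existence.  A nonnegative left null
  vector that vanishes at one state vanishes everywhere.  For uniqueness, apply this to
  \<open>\<bar>\<delta>\<bar> + \<delta>\<close>, where \<open>\<delta>\<close> is the difference of two equilibria: it vanishes somewhere since
  \<open>\<delta>\<close> sums to zero, so \<open>\<delta> \<le> 0\<close> and hence \<open>\<delta> = 0\<close>.  Under the hypotheses on the
  attention probabilities every single-person change of choice has a positive rate, so the
  transition rate matrix is irreducible.
\<close>

locale irreducible_generator =
  fixes M :: "real ^ 'n::finite ^ 'n"
  assumes off_diagonal_nonneg: "x \<noteq> y \<Longrightarrow> 0 \<le> M $ x $ y"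
    and row_sum: "(\<Sum>y\<in>UNIV. M $ x $ y) = 0"
    and irreducible: "(x, y) \<in> {(x, y). 0 < M $ x $ y}\<^sup>*"
begin

lemma diagonal_nonpos: "M $ x $ x \<le> 0"
proof -
  have "M $ x $ x + (\<Sum>y\<in>UNIV - {x}. M $ x $ y) = 0"
    using row_sum[of x] by (simp add: sum.remove[of UNIV x])
  moreover have "0 \<le> (\<Sum>y\<in>UNIV - {x}. M $ x $ y)"
    by (rule sum_nonneg) (auto intro: off_diagonal_nonneg)
  ultimately show ?thesis by linarith
qed

text \<open>The generator conserves total mass: exchanging the two sums exposes the row sums of
  \<open>M\<close>.\<close>

lemma sum_vector_matrix_mult: "(\<Sum>y\<in>UNIV. (\<nu> v* M) $ y) = 0"
proof -
  have "(\<Sum>y\<in>UNIV. (\<nu> v* M) $ y) = (\<Sum>x\<in>UNIV. \<nu> $ x * (\<Sum>y\<in>UNIV. M $ x $ y))"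
    unfolding vector_matrix_mult_def
    by (simp add: sum_distrib_left mult.commute) (rule sum.swap)
  then show ?thesis by (simp add: row_sum)
qed

lemma abs_null_vector:
  assumes "\<mu> v* M = 0"
  shows "(\<chi> x. \<bar>\<mu> $ x\<bar>) v* M = 0"
proof -
  let ?\<nu> = "\<chi> x. \<bar>\<mu> $ x\<bar>"
  have nonneg: "0 \<le> (?\<nu> v* M) $ y" for y
  proof -
    \<comment> \<open>Only the diagonal entry of column \<open>y\<close> may be negative, so its
      term is isolated before absolute values are taken.\<close>
    have "M $ y $ y * \<mu> $ y + (\<Sum>x\<in>UNIV - {y}. M $ x $ y * \<mu> $ x) = (\<mu> v* M) $ y"
      by (simp add: vector_matrix_mult_def mult.commute sum.remove[of UNIV y])
    then have "\<bar>M $ y $ y * \<mu> $ y\<bar> = \<bar>\<Sum>x\<in>UNIV - {y}. M $ x $ y * \<mu> $ x\<bar>"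
      using assms by (simp add: add_eq_0_iff)
    also have "\<dots> \<le> (\<Sum>x\<in>UNIV - {y}. \<bar>M $ x $ y * \<mu> $ x\<bar>)"
      by (rule sum_abs)
    also have "\<dots> = (\<Sum>x\<in>UNIV - {y}. M $ x $ y * \<bar>\<mu> $ x\<bar>)"
      by (rule sum.cong) (auto simp: abs_mult off_diagonal_nonneg)
    \<comment> \<open>Since \<open>M $ y $ y\<close> is nonpositive, the left end of the chain
      equals minus the diagonal term on the right.\<close>
    finally have "0 \<le> M $ y $ y * \<bar>\<mu> $ y\<bar> + (\<Sum>x\<in>UNIV - {y}. M $ x $ y * \<bar>\<mu> $ x\<bar>)"
      using diagonal_nonpos[of y] by (simp add: abs_mult)
    then show ?thesis
      by (simp add: vector_matrix_mult_def mult.commute sum.remove[of UNIV y])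
  qed
  have "(?\<nu> v* M) $ y = 0" for y
    using sum_vector_matrix_mult[of ?\<nu>] nonneg by (simp add: sum_nonneg_eq_0_iff)
  then show ?thesis by (simp add: vec_eq_iff)
qed

text \<open>Zeros spread backwards along positive rates: if \<nu> vanishes at \<open>z\<close>, the
  terms of column \<open>z\<close> are nonnegative with sum zero, so every state that jumps to
  \<open>z\<close> also has \<nu> zero.\<close>

lemma nonneg_null_vector_eq_0:
  assumes null: "\<nu> v* M = 0" and nonneg: "\<And>x. 0 \<le> \<nu> $ x" and zero: "\<nu> $ y = 0"
  shows "\<nu> = 0"
proof -
  have step: "\<nu> $ x = 0" if "0 < M $ x $ z" "\<nu> $ z = 0" for x z
  proof -
    have "(\<Sum>x\<in>UNIV. M $ x $ z * \<nu> $ x) = 0"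
      using null by (simp add: vector_matrix_mult_def vec_eq_iff mult.commute)
    \<comment> \<open>The diagonal term is harmless because its factor \<open>\<nu> $ z\<close> is
      zero.\<close>
    moreover have "0 \<le> M $ x $ z * \<nu> $ x" for x
      using that(2) nonneg off_diagonal_nonneg by (cases "x = z") auto
    ultimately have "M $ x $ z * \<nu> $ x = 0"
      by (simp add: sum_nonneg_eq_0_iff)
    then show ?thesis using that(1) by simp
  qed
  have "\<nu> $ x = 0" for x
    using irreducible[of x y] by (induction rule: converse_rtrancl_induct) (auto simp: zero step)
  then show ?thesis by (simp add: vec_eq_iff)
qed

text \<open>The all-ones vector is a right null vector, so the square matrix \<open>M\<close> is
  singular; hence its transpose is singular too, and a kernel vector of the transpose is a left null
  vector of \<open>M\<close>.\<close>

lemma ex_nonzero_null_vector: "\<exists>\<mu>. \<mu> \<noteq> 0 \<and> \<mu> v* M = 0"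
proof -
  have "M *v 1 = 0" by (simp add: matrix_vector_mult_def vec_eq_iff row_sum)
  moreover have "(1 :: real ^ 'n) \<noteq> 0" by (simp add: vec_eq_iff)
  ultimately have "\<nexists>B. B ** M = mat 1"
    unfolding matrix_left_invertible_ker by blast
  then have "\<nexists>B. B ** transpose M = mat 1"
    using left_invertible_transpose[of M] matrix_left_right_inverse[of M] by blast
  then show ?thesis
    unfolding matrix_left_invertible_ker by auto
qed

theorem ex1_stationary_distribution:
  "\<exists>!\<mu>. (\<forall>x. 0 \<le> \<mu> $ x) \<and> (\<Sum>x\<in>UNIV. \<mu> $ x) = 1 \<and> \<mu> v* M = 0"
proof (rule ex_ex1I)
  obtain \<mu> where \<mu>: "\<mu> \<noteq> 0" "\<mu> v* M = 0"
    using ex_nonzero_null_vector by blast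
  let ?\<nu> = "\<chi> x. \<bar>\<mu> $ x\<bar>"
  define s where "s = (\<Sum>x\<in>UNIV. \<bar>\<mu> $ x\<bar>)"
  have "s \<noteq> 0"
    using \<mu>(1) by (auto simp: s_def sum_nonneg_eq_0_iff vec_eq_iff)
  moreover have "0 \<le> s" by (simp add: s_def sum_nonneg)
  moreover have "((1 / s) *\<^sub>R ?\<nu>) v* M = 0"
    by (simp only: scaleR_vector_matrix_assoc abs_null_vector[OF \<mu>(2)] scaleR_zero_right)
  moreover have "(\<Sum>x\<in>UNIV. ((1 / s) *\<^sub>R ?\<nu>) $ x) = s / s"
    unfolding s_def by (simp flip: sum_divide_distrib)
  ultimately show "\<exists>\<mu>. (\<forall>x. 0 \<le> \<mu> $ x) \<and> (\<Sum>x\<in>UNIV. \<mu> $ x) = 1 \<and> \<mu> v* M = 0"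
    by (intro exI[of _ "(1 / s) *\<^sub>R ?\<nu>"]) simp
next
  fix \<mu> \<mu>'
  assume \<mu>: "(\<forall>x. 0 \<le> \<mu> $ x) \<and> (\<Sum>x\<in>UNIV. \<mu> $ x) = 1 \<and> \<mu> v* M = 0"
    and \<mu>': "(\<forall>x. 0 \<le> \<mu>' $ x) \<and> (\<Sum>x\<in>UNIV. \<mu>' $ x) = 1 \<and> \<mu>' v* M = 0"
  define \<delta> where "\<delta> = \<mu> - \<mu>'"
  have null: "\<delta> v* M = 0"
    using \<mu> \<mu>' by (simp add: \<delta>_def vector_matrix_mult_diff_distrib)
  have sum0: "(\<Sum>x\<in>UNIV. \<delta> $ x) = 0"
    using \<mu> \<mu>' by (simp add: \<delta>_def sum_subtractf)
  have "\<not> (\<forall>y. 0 < \<delta> $ y)"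
    using sum0 sum_pos[of UNIV "\<lambda>x. \<delta> $ x"] by auto
  then obtain y where "\<delta> $ y \<le> 0" by (auto simp: not_less)
  \<comment> \<open>This is twice the positive part of \<delta>, so it vanishes exactly where
    \<delta> is nonpositive.\<close>
  let ?\<nu> = "(\<chi> x. \<bar>\<delta> $ x\<bar>) + \<delta>"
  have "?\<nu> = 0"
  proof (rule nonneg_null_vector_eq_0)
    show "?\<nu> v* M = 0"
      by (simp add: vector_matrix_left_distrib abs_null_vector null)
    show "?\<nu> $ y = 0" using \<open>\<delta> $ y \<le> 0\<close> by simp
  qed simp
  have "\<delta> $ x \<le> 0" for x
  proof -
    have "\<bar>\<delta> $ x\<bar> + \<delta> $ x = 0"
      using \<open>?\<nu> = 0\<close> by (simp add: vec_eq_iff)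
    then show ?thesis by linarith
  qed
  then have "\<delta> $ x = 0" for x
    using sum0 sum_nonneg_eq_0_iff[of UNIV "\<lambda>x. - \<delta> $ x"] by (simp add: sum_negf)
  then have "\<delta> = 0" by (simp add: vec_eq_iff)
  then show "\<mu> = \<mu>'" by (simp add: \<delta>_def)
qed

end

lemma choice_prob_pos:
  assumes "\<And>a v y. 0 < Q a v y \<and> Q a v y < 1"
  shows "0 < choice_prob pref Q a w y"
  using assms by (auto simp: choice_prob_def intro!: prod_pos mult_pos_pos split: option.split)

lemma jump_rate_nonneg:
  assumes "\<And>a. lam a > 0" and "\<And>a v y. 0 < Q a v y \<and> Q a v y < 1"
  shows "0 \<le> jump_rate lam pref Q y' y"
  using assms(1) choice_prob_pos[of Q, OF assms(2)] by (simp add: jump_rate_def Let_def less_imp_le)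

lemma jump_rate_fun_upd:
  assumes "w \<noteq> y a"
  shows "jump_rate lam pref Q (y(a := w)) y = lam a * choice_prob pref Q a w y"
proof -
  \<comment> \<open>The reviser \<open>a\<close> is the only differing coordinate, which settles
    both the unique existence and the \<open>THE\<close> in \<open>jump_rate\<close>.\<close>
  have "(y(a := w)) b \<noteq> y b \<longleftrightarrow> b = a" for b using assms by simp
  then show ?thesis by (simp add: jump_rate_def)
qed

text \<open>Coordinates of \<open>x\<close> are replaced by those of \<open>y\<close> one at a time;
  \<open>A\<close> collects the coordinates already replaced.\<close>

lemma rtrancl_fun_upd:
  fixes x y :: "'p::finite \<Rightarrow> 'c"
  assumes step: "\<And>z a w. w \<noteq> z a \<Longrightarrow> (z, z(a := w)) \<in> R"
  shows "(x, y) \<in> R\<^sup>*"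
proof -
  have "(x, \<lambda>a. if a \<in> A then y a else x a) \<in> R\<^sup>*" for A :: "'p set"
    using finite[of A]
  proof (induction A rule: finite_induct)
    case (insert a A)
    let ?z = "\<lambda>b. if b \<in> A then y b else x b"
    have "(\<lambda>b. if b \<in> insert a A then y b else x b) = ?z(a := y a)" by auto
    moreover have "(?z, ?z(a := y a)) \<in> R\<^sup>*"
    \<comment> \<open>If \<open>x\<close> and \<open>y\<close> agree at \<open>a\<close>, no move in
      \<open>R\<close> is available from \<open>step\<close>, and reflexivity is used
      instead.\<close>
    proof (cases "y a = ?z a")
      case True
      then have "?z(a := y a) = ?z" by (rule fun_upd_idem[OF sym])
      then show ?thesis by simp
    qed (blast intro: step)
    ultimately show ?case using insert.IH by (simp only: rtrancl_trans)
  qed simp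
  from this[of UNIV] show ?thesis by simp
qed

lemma irreducible_generator_transition_matrix:
  assumes lam: "\<And>a. lam a > 0" and Q: "\<And>a v y. 0 < Q a v y \<and> Q a v y < 1"
  shows "irreducible_generator (transition_matrix lam pref Q)"
proof
  fix x y :: "('a, 'b) config"
  show "x \<noteq> y \<Longrightarrow> 0 \<le> transition_matrix lam pref Q $ x $ y"
    using jump_rate_nonneg[of lam Q, OF lam Q]
    by (simp add: transition_matrix_def transition_rate_def)
  have "(\<Sum>z\<in>UNIV - {x}. transition_rate lam pref Q z x)
      = (\<Sum>z\<in>UNIV - {x}. jump_rate lam pref Q z x)"
    by (rule sum.cong) (auto simp: transition_rate_def)
  moreover have "transition_rate lam pref Q x x = - (\<Sum>z\<in>UNIV - {x}. jump_rate lam pref Q z x)"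
    by (simp add: transition_rate_def)
  ultimately show "(\<Sum>y\<in>UNIV. transition_matrix lam pref Q $ x $ y) = 0"
    by (simp add: transition_matrix_def sum.remove[of UNIV x])
  show "(x, y) \<in> {(x, y). 0 < transition_matrix lam pref Q $ x $ y}\<^sup>*"
  proof (rule rtrancl_fun_upd)
    fix z :: "('a, 'b) config" and a w
    assume "w \<noteq> z a"
    moreover from this have "z(a := w) \<noteq> z" by (metis fun_upd_same)
    ultimately show "(z, z(a := w)) \<in> {(x, y). 0 < transition_matrix lam pref Q $ x $ y}"
      using lam choice_prob_pos[of Q, OF Q]
      by (simp add: transition_matrix_def transition_rate_def jump_rate_fun_upd)
  qed
qed

theorem proposition3p1:
  fixes lam :: "'p::finite \<Rightarrow> real"
    and pref :: "'p \<Rightarrow> 'v::finite rel"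
    and Q :: "'p \<Rightarrow> 'v \<Rightarrow> ('p, 'v) config \<Rightarrow> real"
  assumes "\<And>a. lam a > 0"
    and "\<And>a. strict_linear_order_on UNIV (pref a)"
    and "\<And>a v y. 0 < Q a v y \<and> Q a v y < 1"
  shows "\<exists>!\<mu>. equilibrium lam pref Q \<mu>"
proof -
  interpret irreducible_generator "transition_matrix lam pref Q"
    by (rule irreducible_generator_transition_matrix) (fact assms)+
  \<comment> \<open>A single nonnegative weight cannot exceed the total mass, which supplies the
    upper bound demanded by \<open>equilibrium\<close>.\<close>
  have "\<mu> $ y \<le> 1" if "\<forall>y. 0 \<le> \<mu> $ y" "(\<Sum>y\<in>UNIV. \<mu> $ y) = 1"
    for \<mu> :: "real ^ ('p, 'v) config" and y
    using that member_le_sum[of y UNIV "\<lambda>y. \<mu> $ y"] by simp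
  then have "equilibrium lam pref Q \<mu> \<longleftrightarrow>
      (\<forall>y. 0 \<le> \<mu> $ y) \<and> (\<Sum>y\<in>UNIV. \<mu> $ y) = 1 \<and> \<mu> v* transition_matrix lam pref Q = 0" for \<mu>
    unfolding equilibrium_def by blast
  then show ?thesis using ex1_stationary_distribution by simp
qed

end
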